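(* For every partition $\lambda$ with conjugate partition $\lambda'$, $$sp_\lambda=\tfrac12\det(h_{\lambda_i-i+j}+h_{\lambda_i-i-j+2})=\det(\check h_{\lambda_i-i+j}-\check h_{\lambda_i-i-j})$$ $$=\det(e_{\lambda'_i-i+j}-e_{\lambda'_i-i-j})=\tfrac12\det(\hat e_{\lambda'_i-i+j}+\hat e_{\lambda'_i-i-j+2}),$$ $$o_\lambda=\det(h_{\lambda_i-i+j}-h_{\lambda_i-i-j})=\tfrac12\det(\hat h_{\lambda_i-i+j}+\hat h_{\lambda_i-i-j+2})$$ $$=\tfrac12\det(e_{\lambda'_i-i+j}+e_{\lambda'_i-i-j+2})=\det(\check e_{\lambda'_i-i+j}-\check e_{\lambda'_i-i-j}).$$ Here determinants involving $\lambda_i$ have rows and columns indexed by $1\le i,j\le k$ for $\lambda=(\lambda_1,\dots,\lambda_k)$, and those involving $\lambda_i'$ by $1\le i,j\le l$ for $\lambda'=(\lambda'_1,\dots,\lambda'_l)$.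
   Context: $\Lambda=\Lambda_{\mathbb Q}$ is the ring of symmetric functions over $\mathbb Q$ in countably many variables; $h_n$ and $e_n$ are the complete homogeneous and elementary symmetric functions, with $h_0=e_0=1$ and $h_n=e_n=0$ for $n<0$. For all integers $n$ set $$\hat h_n=h_n-h_{n-2},\quad \hat e_n=e_n-e_{n-2},\quad \check h_n=h_n+h_{n-2}+h_{n-4}+\cdots,\quad \check e_n=e_n+e_{n-2}+e_{n-4}+\cdots$$ (so all of these vanish for $n<0$). Partitions are written $\lambda=(\lambda_1\ge\dots\ge\lambda_k\ge0)$ with $k\ge1$ (trailing zeros allowed; the empty partition is written $(0)$). The symplectic and orthogonal Schur functions are by definition $$sp_\lambda=\tfrac12\det(h_{\lambda_i-i+j}+h_{\lambda_i-i-j+2})_{1\le i,j\le k},\qquad o_\lambda=\det(h_{\lambda_i-i+j}-h_{\lambda_i-i-j})_{1\le i,j\le k}.$$ *)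

theory Defs
  imports
    "HOL-Library.Poly_Mapping"
    "Jordan_Normal_Form.Determinant"
begin

section \<open>The ring of symmetric functions over the rationals\<close>

text \<open>
  Variables are indexed by the naturals; a monomial is its finitely supported exponent vector.
  A symmetric function is a formal power series of bounded degree, given by its
  coefficients, that is invariant under all permutations of the variables.
\<close>

type_synonym monomial = "nat \<Rightarrow>\<^sub>0 nat"

definition mdeg :: "monomial \<Rightarrow> nat" where
  "mdeg m = (\<Sum>i\<in>Poly_Mapping.keys m. Poly_Mapping.lookup m i)"

definition permute :: "(nat \<Rightarrow> nat) \<Rightarrow> monomial \<Rightarrow> monomial" where
  "permute \<pi> m = Poly_Mapping.map_key \<pi> m"

definition symmetric :: "(monomial \<Rightarrow> rat) \<Rightarrow> bool" where
  "symmetric f \<longleftrightarrow> (\<forall>\<pi> m. bij \<pi> \<longrightarrow> f (permute \<pi> m) = f m)"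

definition bounded_degree :: "(monomial \<Rightarrow> rat) \<Rightarrow> bool" where
  "bounded_degree f \<longleftrightarrow> (\<exists>d. \<forall>m. f m \<noteq> 0 \<longrightarrow> mdeg m \<le> d)"

definition conv :: "(monomial \<Rightarrow> rat) \<Rightarrow> (monomial \<Rightarrow> rat) \<Rightarrow> monomial \<Rightarrow> rat" where
  "conv f g m = (\<Sum>(a, b) | a + b = m. f a * g b)"

lemma lookup_permute:
  "bij \<pi> \<Longrightarrow> Poly_Mapping.lookup (permute \<pi> m) i = Poly_Mapping.lookup m (\<pi> i)"
  by (simp add: permute_def map_key.rep_eq bij_is_inj)

lemma permute_add: "bij \<pi> \<Longrightarrow> permute \<pi> (a + b) = permute \<pi> a + permute \<pi> b"
  by (rule poly_mapping_eqI) (simp add: lookup_permute lookup_add)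

lemma permute_inv:
  assumes "bij \<pi>"
  shows "permute \<pi> (permute (inv_into UNIV \<pi>) m) = m" "permute (inv_into UNIV \<pi>) (permute \<pi> m) = m"
  using assms
  by (auto intro!: poly_mapping_eqI
      simp: lookup_permute bij_imp_bij_inv bij_is_inj bij_is_surj surj_f_inv_f)

lemma permute_eq_0_iff: "bij \<pi> \<Longrightarrow> permute \<pi> m = 0 \<longleftrightarrow> m = 0"
  by (metis add_cancel_right_right permute_add permute_inv(2))

lemma keys_permute:
  "bij \<pi> \<Longrightarrow> Poly_Mapping.keys (permute \<pi> m) = \<pi> -` Poly_Mapping.keys m"
  by (simp add: permute_def keys_map_key bij_is_inj)

lemma mdeg_permute:
  assumes "bij \<pi>"
  shows "mdeg (permute \<pi> m) = mdeg m"
  unfolding mdeg_def keys_permute[OF assms] lookup_permute[OF assms]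
  by (rule sum.reindex_bij_witness[of _ "inv_into UNIV \<pi>" \<pi>])
     (use assms in \<open>auto simp: bij_is_inj bij_is_surj surj_f_inv_f\<close>)

lemma mdeg_superset:
  assumes "finite A" "Poly_Mapping.keys m \<subseteq> A"
  shows "mdeg m = (\<Sum>i\<in>A. Poly_Mapping.lookup m i)"
  unfolding mdeg_def
  by (rule sum.mono_neutral_left) (use assms in \<open>auto simp: in_keys_iff\<close>)

lemma mdeg_add: "mdeg (a + b) = mdeg a + mdeg b"
proof -
  let ?A = "Poly_Mapping.keys a \<union> Poly_Mapping.keys b"
  have "mdeg (a + b) = (\<Sum>i\<in>?A. Poly_Mapping.lookup (a + b) i)"
    by (rule mdeg_superset) (auto simp: keys_add)
  also have "\<dots> = mdeg a + mdeg b"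
    by (simp add: lookup_add sum.distrib mdeg_superset[of ?A])
  finally show ?thesis .
qed

lemma finite_splits: "finite {(a, b). a + b = (m :: monomial)}"
proof -
  let ?B = "\<Union>i\<in>Poly_Mapping.keys m. {..Poly_Mapping.lookup m i}"
  let ?F = "{f. \<forall>x. (x \<in> Poly_Mapping.keys m \<longrightarrow> f x \<in> ?B) \<and>
    (x \<notin> Poly_Mapping.keys m \<longrightarrow> f x = (0::nat))}"
  have fin: "finite ?F"
    by (rule finite_set_of_finite_funs) auto
  have "Poly_Mapping.lookup a \<in> ?F" if "a + b = m" for a b
  proof -
    have le: "Poly_Mapping.lookup a x \<le> Poly_Mapping.lookup m x" for x
      using that by (auto simp: lookup_add)
    have z: "Poly_Mapping.lookup a x = 0" if "x \<notin> Poly_Mapping.keys m" for x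
      using le[of x] that by (simp add: in_keys_iff)
    show ?thesis
      using le z by auto
  qed
  then have "(\<lambda>p. Poly_Mapping.lookup (fst p)) ` {(a, b). a + b = m} \<subseteq> ?F"
    by auto
  then have "finite ((\<lambda>p. Poly_Mapping.lookup (fst p)) ` {(a, b). a + b = m})"
    using fin by (rule finite_subset)
  then show ?thesis
    by (rule finite_imageD) (auto simp: inj_on_def)
qed

lemma splits_eq: "{(a, b). a + b = (m :: monomial)} = {p. fst p + snd p = m}"
  by auto

lemma finite_splits': "finite {p. fst p + snd p = (m :: monomial)}"
  using finite_splits by (simp add: splits_eq)

lemma conv_alt: "conv f g m = (\<Sum>p | fst p + snd p = m. f (fst p) * g (snd p))"
  by (simp add: conv_def splits_eq case_prod_beta)

lemma conv_commute: "conv f g = conv g f"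
  unfolding conv_def
  by (rule ext, rule sum.reindex_bij_witness[of _ "\<lambda>(a, b). (b, a)" "\<lambda>(a, b). (b, a)"])
     (auto simp: algebra_simps)

lemma conv_assoc: "conv (conv f g) h = conv f (conv g h)"
proof
  fix m
  have "conv (conv f g) h m =
    (\<Sum>p | fst p + snd p = m. \<Sum>q | fst q + snd q = fst p. f (fst q) * g (snd q) * h (snd p))"
    by (simp add: conv_alt sum_distrib_right)
  also have "\<dots> = (\<Sum>z\<in>(SIGMA p:{p. fst p + snd p = m}. {q. fst q + snd q = fst p}).
      f (fst (snd z)) * g (snd (snd z)) * h (snd (fst z)))"
    by (subst sum.Sigma) (use finite_splits' in \<open>auto simp: case_prod_beta\<close>)
  also have "\<dots> = (\<Sum>z\<in>(SIGMA p:{p. fst p + snd p = m}. {q. fst q + snd q = snd p}).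
      f (fst (fst z)) * (g (fst (snd z)) * h (snd (snd z))))"
    by (rule sum.reindex_bij_witness[of _
          "\<lambda>((c, e), (d, b)). ((c + d, b), (c, d))" "\<lambda>((a, b), (c, d)). ((c, d + b), (d, b))"])
       (auto simp: algebra_simps)
  also have "\<dots> =
    (\<Sum>p | fst p + snd p = m. \<Sum>q | fst q + snd q = snd p. f (fst p) * (g (fst q) * h (snd q)))"
    by (subst sum.Sigma) (use finite_splits' in \<open>auto simp: case_prod_beta\<close>)
  also have "\<dots> = conv f (conv g h) m"
    by (simp add: conv_alt sum_distrib_left)
  finally show "conv (conv f g) h m = conv f (conv g h) m" .
qed

lemma conv_one: "conv (\<lambda>m. if m = 0 then 1 else 0) f = f"
proof
  fix m
  have "conv (\<lambda>m. if m = 0 then 1 else 0) f m =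
    (\<Sum>p\<in>{(0 :: monomial, m)}. (if fst p = 0 then 1 else 0) * f (snd p))"
    unfolding conv_alt by (rule sum.mono_neutral_right) (use finite_splits' in auto)
  then show "conv (\<lambda>m. if m = 0 then 1 else 0) f m = f m"
    by simp
qed

lemma conv_add: "conv (\<lambda>m. f m + g m) h m = conv f h m + conv g h m"
  by (simp add: conv_def case_prod_beta algebra_simps sum.distrib)

lemma symmetric_conv:
  assumes "symmetric f" "symmetric g"
  shows "symmetric (conv f g)"
  unfolding symmetric_def
proof (intro allI impI)
  fix \<pi> :: "nat \<Rightarrow> nat" and m
  assume \<pi>: "bij \<pi>"
  have \<pi>': "bij (inv_into UNIV \<pi>)"
    using \<pi> by (rule bij_imp_bij_inv)
  show "conv f g (permute \<pi> m) = conv f g m"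
    unfolding conv_def
    by (rule sum.reindex_bij_witness[of _
          "\<lambda>(a, b). (permute \<pi> a, permute \<pi> b)"
          "\<lambda>(a, b). (permute (inv_into UNIV \<pi>) a, permute (inv_into UNIV \<pi>) b)"])
       (use assms \<pi> \<pi>' in \<open>auto simp: permute_inv symmetric_def
          simp flip: permute_add\<close>)
qed

lemma bounded_degree_conv:
  assumes "bounded_degree f" "bounded_degree g"
  shows "bounded_degree (conv f g)"
proof -
  obtain d d' where d: "\<And>m. f m \<noteq> 0 \<Longrightarrow> mdeg m \<le> d" "\<And>m. g m \<noteq> 0 \<Longrightarrow> mdeg m \<le> d'"
    using assms by (auto simp: bounded_degree_def)
  have "mdeg m \<le> d + d'" if nz: "conv f g m \<noteq> 0" for m
  proof -
    obtain p where "p \<in> {(a, b). a + b = m}" "(case p of (a, b) \<Rightarrow> f a * g b) \<noteq> 0"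
      using nz unfolding conv_def by (rule sum.not_neutral_contains_not_neutral)
    then obtain a b where "m = a + b" "f a \<noteq> 0" "g b \<noteq> 0"
      by auto
    then show ?thesis
      using d(1)[of a] d(2)[of b] by (simp add: mdeg_add)
  qed
  then show ?thesis
    by (auto simp: bounded_degree_def)
qed

lemma bounded_degree_add:
  assumes "bounded_degree f" "bounded_degree g"
  shows "bounded_degree (\<lambda>m. f m + g m)"
proof -
  obtain d d' where d: "\<And>m. f m \<noteq> 0 \<Longrightarrow> mdeg m \<le> d" "\<And>m. g m \<noteq> 0 \<Longrightarrow> mdeg m \<le> d'"
    using assms by (auto simp: bounded_degree_def)
  have "mdeg m \<le> max d d'" if "f m + g m \<noteq> 0" for m
    using that d[of m] by (cases "f m = 0") (auto simp: le_max_iff_disj)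
  then show ?thesis
    by (auto simp: bounded_degree_def)
qed

typedef symfun = "{f :: monomial \<Rightarrow> rat. symmetric f \<and> bounded_degree f}"
  morphisms coefficient Abs_symfun
  by (rule exI[of _ "\<lambda>_. 0"]) (auto simp: symmetric_def bounded_degree_def)

setup_lifting type_definition_symfun

instantiation symfun :: comm_ring_1
begin

lift_definition zero_symfun :: symfun is "\<lambda>_. 0"
  by (auto simp: symmetric_def bounded_degree_def)

lift_definition one_symfun :: symfun is "\<lambda>m. if m = 0 then 1 else 0"
  by (auto simp: symmetric_def bounded_degree_def permute_eq_0_iff)

lift_definition plus_symfun :: "symfun \<Rightarrow> symfun \<Rightarrow> symfun" is "\<lambda>f g m. f m + g m"
  by (auto simp: symmetric_def bounded_degree_add)

lift_definition uminus_symfun :: "symfun \<Rightarrow> symfun" is "\<lambda>f m. - f m"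
  by (auto simp: symmetric_def bounded_degree_def)

definition minus_symfun :: "symfun \<Rightarrow> symfun \<Rightarrow> symfun" where
  "minus_symfun f g = f + - g"

lift_definition times_symfun :: "symfun \<Rightarrow> symfun \<Rightarrow> symfun" is conv
  by (auto simp: symmetric_conv bounded_degree_conv)

instance
proof
  fix a b c :: symfun
  show "a * b * c = a * (b * c)"
    by transfer (rule conv_assoc)
  show "a * b = b * a"
    by transfer (rule conv_commute)
  show "1 * a = a"
    by transfer (rule conv_one)
  show "(a + b) * c = a * c + b * c"
    by transfer (rule ext, rule conv_add)
  show "a + b + c = a + (b + c)"
    by transfer (simp add: algebra_simps)
  show "a + b = b + a"
    by transfer (simp add: algebra_simps)
  show "0 + a = a"
    by transfer simp
  show "- a + a = 0"
    by transfer simp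
  show "a - b = a + - b"
    by (rule minus_symfun_def)
  show "(0 :: symfun) \<noteq> 1"
    by transfer (metis zero_neq_one)
qed

end

lift_definition qscale :: "rat \<Rightarrow> symfun \<Rightarrow> symfun"  (infixr \<open>*\<^sub>Q\<close> 75) is "\<lambda>q f m. q * f m"
  by (auto simp: symmetric_def bounded_degree_def)

lemma qscale_vector_space: "vector_space qscale"
  by unfold_locales (transfer; simp add: algebra_simps)+

lemma qscale_mult_left: "(q *\<^sub>Q a) * b = q *\<^sub>Q (a * b)"
  by transfer (simp add: fun_eq_iff conv_def case_prod_beta sum_distrib_left algebra_simps)


section \<open>Complete homogeneous and elementary symmetric functions\<close>

text \<open>
  \<open>h n\<close> is the sum of all monomials of degree \<open>n\<close>, and \<open>e n\<close> the sum of the squarefree ones;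
  both are empty sums for negative \<open>n\<close>.
\<close>

lift_definition h :: "int \<Rightarrow> symfun" is "\<lambda>n m. if int (mdeg m) = n then 1 else 0"
  by (simp add: symmetric_def bounded_degree_def mdeg_permute) (metis nat_int order_refl)

lift_definition e :: "int \<Rightarrow> symfun" is
  "\<lambda>n m. if int (mdeg m) = n \<and> (\<forall>i. Poly_Mapping.lookup m i \<le> 1) then 1 else 0"
proof -
  fix n :: int
  let ?f = "\<lambda>m. if int (mdeg m) = n \<and> (\<forall>i. Poly_Mapping.lookup m i \<le> 1) then 1 else 0 :: rat"
  have "(\<forall>i. Poly_Mapping.lookup (permute \<pi> m) i \<le> 1) \<longleftrightarrow> (\<forall>i. Poly_Mapping.lookup m i \<le> 1)"
    if "bij \<pi>" for \<pi> m
    using that by (metis lookup_permute bij_pointE)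
  then have "symmetric ?f"
    by (simp add: symmetric_def mdeg_permute)
  moreover have "bounded_degree ?f"
    by (simp add: bounded_degree_def) (metis nat_int order_refl)
  ultimately show "symmetric ?f \<and> bounded_degree ?f" ..
qed

lemma h_neg: "n < 0 \<Longrightarrow> h n = 0"
  by transfer auto

lemma e_neg: "n < 0 \<Longrightarrow> e n = 0"
  by transfer auto

lemma mdeg_eq_0_iff: "mdeg m = 0 \<longleftrightarrow> m = 0"
  by (auto simp: mdeg_def in_keys_iff intro!: poly_mapping_eqI)

lemma h_0: "h 0 = 1"
  by transfer (simp add: mdeg_eq_0_iff)

lemma e_0: "e 0 = 1"
  by transfer (auto simp: mdeg_eq_0_iff fun_eq_iff)

definition h_hat :: "int \<Rightarrow> symfun" where
  "h_hat n = h n - h (n - 2)"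

definition e_hat :: "int \<Rightarrow> symfun" where
  "e_hat n = e n - e (n - 2)"

text \<open>
  The infinite sums \<open>h n + h (n - 2) + h (n - 4) + \<dots>\<close> are truncated after the summand
  \<open>h (n - 2 n) = h (- n)\<close>; everything omitted has negative index and is zero.
\<close>

definition h_check :: "int \<Rightarrow> symfun" where
  "h_check n = (\<Sum>r\<le>nat n. h (n - 2 * int r))"

definition e_check :: "int \<Rightarrow> symfun" where
  "e_check n = (\<Sum>r\<le>nat n. e (n - 2 * int r))"


section \<open>Partitions and determinants\<close>

definition is_partition :: "nat list \<Rightarrow> bool" where
  "is_partition lam \<longleftrightarrow> lam \<noteq> [] \<and> sorted_wrt (\<ge>) lam"

text \<open>Parts are indexed from 1, and \<open>part lam i\<close> is zero beyond the length of the list.\<close>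

definition part :: "nat list \<Rightarrow> int \<Rightarrow> int" where
  "part lam i = (if 1 \<le> i \<and> i \<le> int (length lam) then int (lam ! nat (i - 1)) else 0)"

text \<open>
  Since trailing zeros are allowed, the conjugate is determined only up to trailing zeros,
  so conjugacy is a relation between lists.
\<close>

definition is_conjugate :: "nat list \<Rightarrow> nat list \<Rightarrow> bool" where
  "is_conjugate lam mu \<longleftrightarrow>
    (\<forall>j\<ge>1. part mu j = int (card {i. 1 \<le> i \<and> i \<le> int (length lam) \<and> part lam i \<ge> j}))"

text \<open>\<open>detij k a\<close> is the determinant of the \<open>k \<times> k\<close> matrix with entries \<open>a i j\<close>, \<open>1 \<le> i, j \<le> k\<close>.\<close>

definition detij :: "nat \<Rightarrow> (int \<Rightarrow> int \<Rightarrow> 'a :: comm_ring_1) \<Rightarrow> 'a" where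
  "detij k a = det (mat k k (\<lambda>(r, c). a (int r + 1) (int c + 1)))"

definition sp :: "nat list \<Rightarrow> symfun" where
  "sp lam = (1/2) *\<^sub>Q detij (length lam)
     (\<lambda>i j. h (part lam i - i + j) + h (part lam i - i - j + 2))"

definition orth :: "nat list \<Rightarrow> symfun" where
  "orth lam = detij (length lam) (\<lambda>i j. h (part lam i - i + j) - h (part lam i - i - j))"

end

theory Submission
  imports Defs
begin

text \<open>
  If \<open>f n = g n - g (n - 2)\<close>, subtracting column \<open>j - 2\<close> from column \<open>j\<close> of the matrix with
  entries \<open>g (\<alpha> i + j) - g (\<alpha> i - j)\<close> gives the matrix with entries
  \<open>f (\<alpha> i + j) + f (\<alpha> i - j + 2)\<close>, except that the first column of the latter is doubled; this
  accounts for every factor one half.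

  The passage from \<open>h\<close> to \<open>e\<close> is Jacobi's complementary minor theorem. The matrices
  \<open>h (p - q)\<close> and \<open>(-1) ^ (p - q) * e (p - q)\<close> with \<open>0 \<le> p, q < k + l\<close> are mutually inverse.
  Subtracting column \<open>k + j\<close> from column \<open>k - j\<close> of the first means adding row \<open>k - j\<close> to row
  \<open>k + j\<close> of its inverse. The rows \<open>\<lambda>\<^sub>i + k - i\<close> then cut out the orthogonal determinant in \<open>h\<close>,
  while the complementary columns \<open>k - 1 + j - \<lambda>'\<^sub>j\<close> of the inverse cut out the determinant in \<open>e\<close>.
  The signs cancel because both equal \<open>(-1) ^ |\<lambda>|\<close>. Exchanging \<open>h\<close> and \<open>e\<close> handles the
  symplectic case.
\<close>

section \<open>Conjugate partitions in a box\<close>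

text \<open>Indices start at 0, and the last clause says that both sequences describe the same set
  of cells. This form is symmetric under transposition and already forces both sequences to decrease
  weakly.\<close>

definition box_conjugate :: "nat \<Rightarrow> nat \<Rightarrow> (nat \<Rightarrow> nat) \<Rightarrow> (nat \<Rightarrow> nat) \<Rightarrow> bool" where
  "box_conjugate k l a b \<longleftrightarrow> (\<forall>i<k. a i \<le> l) \<and> (\<forall>j<l. b j \<le> k) \<and>
     (\<forall>i<k. \<forall>j<l. j < a i \<longleftrightarrow> i < b j)"

lemma box_conjugate_sym: "box_conjugate k l a b \<Longrightarrow> box_conjugate l k b a"
  by (auto simp: box_conjugate_def)

text \<open>If \<open>a i < a i'\<close>, the cell in row \<open>i'\<close> and column
  \<open>a i\<close> lies in the diagram. Then so does the cell of that column in the higher row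
  \<open>i\<close>, which gives \<open>a i < a i\<close>.\<close>

lemma box_conjugate_antimono:
  assumes "box_conjugate k l a b" "i \<le> i'" "i' < k"
  shows "a i' \<le> a i"
proof (rule ccontr)
  assume "\<not> a i' \<le> a i"
  then have "a i < a i'" by simp
  moreover have "a i' \<le> l" using assms by (auto simp: box_conjugate_def)
  ultimately have "a i < a i"
    using assms unfolding box_conjugate_def by (meson le_less_trans less_le_trans)
  then show False by simp
qed

lemma box_conjugate_sum:
  assumes "box_conjugate k l a b"
  shows "(\<Sum>i<k. a i) = (\<Sum>j<l. b j)"
proof -
  have "(\<Sum>i<k. a i) = (\<Sum>i<k. \<Sum>j<l. if j < a i then 1 else 0)"
  proof (rule sum.cong[OF refl])
    fix i assume "i \<in> {..<k}"
    then have "a i \<le> l" using assms by (auto simp: box_conjugate_def)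
    then have "{j. j < l \<and> j < a i} = {..<a i}" by auto
    then show "a i = (\<Sum>j<l. if j < a i then 1 else 0)"
      by (simp flip: sum.inter_filter)
  qed
  also have "\<dots> = (\<Sum>j<l. \<Sum>i<k. if i < b j then 1 else 0)"
    by (subst sum.swap) (use assms in \<open>auto intro!: sum.cong simp: box_conjugate_def\<close>)
  also have "\<dots> = (\<Sum>j<l. b j)"
  proof (rule sum.cong[OF refl])
    fix j assume "j \<in> {..<l}"
    then have "b j \<le> k" using assms by (auto simp: box_conjugate_def)
    then have "{i. i < k \<and> i < b j} = {..<b j}" by auto
    then show "(\<Sum>i<k. if i < b j then 1 else 0) = b j"
      by (simp flip: sum.inter_filter)
  qed
  finally show ?thesis .
qed

text \<open>The two branches are the beta-numbers of the partition and their complement, read off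
  the conjugate: the positions of the two kinds of steps on the boundary path of the
  diagram.\<close>

definition shuffle_perm :: "nat \<Rightarrow> (nat \<Rightarrow> nat) \<Rightarrow> (nat \<Rightarrow> nat) \<Rightarrow> nat \<Rightarrow> nat" where
  "shuffle_perm k a b r = (if r < k then a r + (k - 1 - r) else r - b (r - k))"

lemma shuffle_perm_less:
  assumes "box_conjugate k l a b" "r < k + l"
  shows "shuffle_perm k a b r < k + l"
proof -
  have "r < k \<Longrightarrow> a r \<le> l" using assms by (auto simp: box_conjugate_def)
  then show ?thesis using assms(2) by (auto simp: shuffle_perm_def)
qed

text \<open>The first branch strictly decreases and the second strictly increases. Across the
  branches the cell \<open>(r, j)\<close> decides: if it lies in the diagram the beta-number exceeds
  \<open>k + j - b j\<close>, otherwise it is smaller.\<close>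

lemma shuffle_perm_inj_on:
  assumes "box_conjugate k l a b"
  shows "inj_on (shuffle_perm k a b) {..<k + l}"
proof (rule linorder_inj_onI)
  fix r s assume rs: "r < s" "r \<in> {..<k + l}" "s \<in> {..<k + l}"
  have le: "b (r - k) \<le> k" if "r < k + l" "k \<le> r" for r
    using assms that by (auto simp: box_conjugate_def)
  consider "s < k" | "k \<le> r" | "r < k" "k \<le> s" by linarith
  then show "shuffle_perm k a b r \<noteq> shuffle_perm k a b s"
  proof cases
    case 1
    then show ?thesis
      using box_conjugate_antimono[OF assms, of r s] rs by (auto simp: shuffle_perm_def)
  next
    case 2
    then have "b (s - k) \<le> b (r - k)"
      using box_conjugate_antimono[OF box_conjugate_sym[OF assms], of "r - k" "s - k"] rs by auto
    then show ?thesis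
      using le[of r] le[of s] 2 rs by (auto simp: shuffle_perm_def)
  next
    case 3
    define j where "j = s - k"
    have s: "s = k + j" and j: "j < l" using 3 rs by (auto simp: j_def)
    have "j < a r \<longleftrightarrow> r < b j" "b j \<le> k" "a r \<le> l"
      using assms 3 j by (auto simp: box_conjugate_def)
    then show ?thesis
      using 3 s by (auto simp: shuffle_perm_def)
  qed
qed auto

text \<open>Induction removes the first row of the diagram, so every nonempty column gets shorter by
  one. The entry 1 of the top matrix row sits in column \<open>a 0 + k\<close>, and its cofactor
  supplies the sign.\<close>

lemma det_shuffle_perm:
  assumes "box_conjugate k l a b"
  shows "det (mat (k + l) (k + l) (\<lambda>(r, c). if shuffle_perm k a b r = c then 1 else 0 :: 'a :: comm_ring_1))
    = (\<Prod>i<k. (-1) ^ (a i + (k - 1 - i)))"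
  using assms
proof (induction k arbitrary: a b)
  case 0
  have "mat (0 + l) (0 + l) (\<lambda>(r, c). if shuffle_perm 0 a b r = c then 1 else 0 :: 'a) = 1\<^sub>m l"
    using 0 by (auto intro!: eq_matI simp: shuffle_perm_def box_conjugate_def)
  then show ?case by simp
next
  case (Suc k)
  define a' b' where "a' = (\<lambda>i. a (Suc i))" and "b' = (\<lambda>j. b j - 1)"
  have bc': "box_conjugate k l a' b'"
    using Suc.prems by (fastforce simp: box_conjugate_def a'_def b'_def)
  define P where "P = mat (Suc k + l) (Suc k + l)
    (\<lambda>(r, c). if shuffle_perm (Suc k) a b r = c then 1 else 0 :: 'a)"
  have s0: "shuffle_perm (Suc k) a b 0 = a 0 + k" by (simp add: shuffle_perm_def)
  have a0: "a 0 \<le> l" using Suc.prems by (auto simp: box_conjugate_def)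
  have del: "mat_delete P 0 (a 0 + k) =
    mat (k + l) (k + l) (\<lambda>(r, c). if shuffle_perm k a' b' r = c then 1 else 0)"
  proof (rule eq_matI)
    fix r c assume "r < dim_row (mat (k + l) (k + l)
        (\<lambda>(r, c). if shuffle_perm k a' b' r = c then 1 else 0 :: 'a))"
      "c < dim_col (mat (k + l) (k + l)
        (\<lambda>(r, c). if shuffle_perm k a' b' r = c then 1 else 0 :: 'a))"
    then have rc: "r < k + l" "c < k + l" by auto
    \<comment> \<open>Deletion renumbers the columns beyond \<open>a 0 + k\<close>. Values from a
      row or a nonempty column of the diagram lie below that index and stay. An empty column gives a
      larger value, and there the truncated subtraction in \<open>b'\<close> accounts for the
      shift.\<close>
    have "shuffle_perm (Suc k) a b (Suc r) = (if c < a 0 + k then c else Suc c)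
      \<longleftrightarrow> shuffle_perm k a' b' r = c"
    proof (cases "r < k")
      case True
      have "a (Suc r) \<le> a 0"
        using True by (intro box_conjugate_antimono[OF Suc.prems]) auto
      then show ?thesis using True by (auto simp: shuffle_perm_def a'_def)
    next
      case False
      define j where "j = r - k"
      have r: "r = k + j" and j: "j < l" using False rc by (auto simp: j_def)
      have "j < a 0 \<longleftrightarrow> 0 < b j" "b j \<le> Suc k"
        using Suc.prems j by (auto simp: box_conjugate_def)
      then show ?thesis using False r by (auto simp: shuffle_perm_def b'_def)
    qed
    then show "mat_delete P 0 (a 0 + k) $$ (r, c) = mat (k + l) (k + l)
        (\<lambda>(r, c). if shuffle_perm k a' b' r = c then 1 else 0) $$ (r, c)"
      using rc by (auto simp: mat_delete_def P_def)
  qed (auto simp: mat_delete_def P_def)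
  have "det P = (\<Sum>j<Suc k + l. P $$ (0, j) * cofactor P 0 j)"
    by (rule laplace_expansion_row) (auto simp: P_def)
  also have "\<dots> = (\<Sum>j<Suc k + l. if j = a 0 + k then cofactor P 0 j else 0)"
    by (intro sum.cong) (auto simp: P_def s0)
  also have "\<dots> = cofactor P 0 (a 0 + k)"
    using a0 by (auto simp: add.commute)
  also have "\<dots> = (-1) ^ (a 0 + k) * (\<Prod>i<k. (-1) ^ (a (Suc i) + (k - 1 - i)))"
    by (simp add: cofactor_def del Suc.IH[OF bc'], simp add: a'_def)
  also have "\<dots> = (\<Prod>i<Suc k. (-1) ^ (a i + (Suc k - 1 - i)))"
    by (subst prod.lessThan_Suc_shift) simp
  finally show ?case by (simp add: P_def)
qed

section \<open>Complementary minors\<close>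

lemma det_unit_columns_left:
  fixes A :: "'a :: comm_ring_1 mat"
  assumes "A \<in> carrier_mat (k + l) (k + l)"
    and "\<And>i j. i < k + l \<Longrightarrow> j < k \<Longrightarrow> A $$ (i, j) = (if i = j then 1 else 0)"
  shows "det A = det (mat l l (\<lambda>(i, j). A $$ (k + i, k + j)))"
  using assms
proof (induction k arbitrary: A)
  case 0
  then have "mat l l (\<lambda>(i, j). A $$ (0 + i, 0 + j)) = A" by (auto intro!: eq_matI)
  then show ?case by simp
next
  case (Suc k)
  have "det A = (\<Sum>i<Suc k + l. A $$ (i, 0) * cofactor A i 0)"
    using Suc.prems(1) by (rule laplace_expansion_column) simp
  also have "\<dots> = (\<Sum>i<Suc k + l. if i = 0 then cofactor A i 0 else 0)"
    by (intro sum.cong) (auto simp: Suc.prems(2))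
  also have "\<dots> = det (mat_delete A 0 0)"
    by (simp add: cofactor_def)
  also have "\<dots> = det (mat l l (\<lambda>(i, j). mat_delete A 0 0 $$ (k + i, k + j)))"
    by (rule Suc.IH) (use Suc.prems in \<open>auto simp: mat_delete_def\<close>)
  also have "mat l l (\<lambda>(i, j). mat_delete A 0 0 $$ (k + i, k + j)) =
      mat l l (\<lambda>(i, j). A $$ (Suc k + i, Suc k + j))"
    by (rule eq_matI) (use Suc.prems(1) in \<open>auto simp: mat_delete_def\<close>)
  finally show ?case .
qed

lemma det_unit_columns_right:
  fixes A :: "'a :: comm_ring_1 mat"
  assumes "A \<in> carrier_mat (k + l) (k + l)"
    and "\<And>i j. i < k + l \<Longrightarrow> j < l \<Longrightarrow> A $$ (i, k + j) = (if i = k + j then 1 else 0)"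
  shows "det A = det (mat k k (\<lambda>(i, j). A $$ (i, j)))"
  using assms
proof (induction l arbitrary: A)
  case 0
  then have "mat k k (\<lambda>(i, j). A $$ (i, j)) = A" by (auto intro!: eq_matI)
  then show ?case by simp
next
  case (Suc l)
  have "det A = (\<Sum>i<k + Suc l. A $$ (i, k + l) * cofactor A i (k + l))"
    using Suc.prems(1) by (rule laplace_expansion_column) simp
  also have "\<dots> = (\<Sum>i<k + Suc l. if i = k + l then cofactor A i (k + l) else 0)"
    by (intro sum.cong) (auto simp: Suc.prems(2))
  also have "\<dots> = det (mat_delete A (k + l) (k + l))"
    by (simp add: cofactor_def)
  also have "\<dots> = det (mat k k (\<lambda>(i, j). mat_delete A (k + l) (k + l) $$ (i, j)))"
    by (rule Suc.IH) (use Suc.prems in \<open>auto simp: mat_delete_def\<close>)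
  also have "mat k k (\<lambda>(i, j). mat_delete A (k + l) (k + l) $$ (i, j)) = mat k k (\<lambda>(i, j). A $$ (i, j))"
    by (rule eq_matI) (use Suc.prems(1) in \<open>auto simp: mat_delete_def\<close>)
  finally show ?case .
qed

text \<open>Jacobi's theorem without division: the row-permuted \<open>M\<close> times
  \<open>?X\<close> is \<open>?R\<close>. Here \<open>?X\<close> has \<open>k\<close> unit columns
  followed by columns of \<open>W\<close>, which \<open>inv\<close> turns into the unit columns of
  \<open>?R\<close>, so that \<open>det ?X\<close> and \<open>det ?R\<close> both collapse to
  minors.\<close>

lemma complementary_minor:
  fixes M W :: "nat \<Rightarrow> nat \<Rightarrow> 'a :: comm_ring_1"
  assumes inv: "\<And>p q. p < k + l \<Longrightarrow> q < k + l \<Longrightarrow>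
      (\<Sum>c<k + l. M p c * W c q) = (if p = q then 1 else 0)"
    and \<sigma>: "\<And>r. r < k + l \<Longrightarrow> \<sigma> r < k + l" "inj_on \<sigma> {..<k + l}"
  shows "det (mat k k (\<lambda>(r, c). M (\<sigma> r) c)) =
    det (mat (k + l) (k + l) (\<lambda>(r, c). M (\<sigma> r) c)) *
    det (mat l l (\<lambda>(i, j). W (k + i) (\<sigma> (k + j))))"
proof -
  let ?N = "k + l"
  let ?M = "mat ?N ?N (\<lambda>(r, c). M (\<sigma> r) c)"
  let ?X = "mat ?N ?N (\<lambda>(r, s). if s < k then if r = s then 1 else 0 else W r (\<sigma> s))"
  let ?R = "mat ?N ?N (\<lambda>(r, s). if s < k then M (\<sigma> r) s else if r = s then 1 else 0)"
  have "?M * ?X = ?R"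
  proof (rule eq_matI)
    fix r s assume "r < dim_row ?R" "s < dim_col ?R"
    then have rs: "r < ?N" "s < ?N" by auto
    then have "(?M * ?X) $$ (r, s) =
        (\<Sum>c<?N. M (\<sigma> r) c * (if s < k then if c = s then 1 else 0 else W c (\<sigma> s)))"
      by (simp add: scalar_prod_def atLeast0LessThan)
    also have "\<dots> = ?R $$ (r, s)"
    proof (cases "s < k")
      case True
      have "(\<Sum>c<?N. M (\<sigma> r) c * (if c = s then 1 else 0)) =
          (\<Sum>c<?N. if c = s then M (\<sigma> r) c else 0)"
        by (intro sum.cong) auto
      then show ?thesis using True rs by simp
    next
      case False
      have "\<sigma> r = \<sigma> s \<longleftrightarrow> r = s" using \<sigma>(2) rs by (auto simp: inj_on_def)
      then show ?thesis using False rs inv[of "\<sigma> r" "\<sigma> s"] \<sigma>(1) by simp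
    qed
    finally show "(?M * ?X) $$ (r, s) = ?R $$ (r, s)" .
  qed auto
  then have "det ?M * det ?X = det ?R"
    by (subst det_mult[symmetric, of _ ?N]) auto
  moreover have "det ?X = det (mat l l (\<lambda>(i, j). ?X $$ (k + i, k + j)))"
    by (rule det_unit_columns_left) auto
  moreover have "mat l l (\<lambda>(i, j). ?X $$ (k + i, k + j)) = mat l l (\<lambda>(i, j). W (k + i) (\<sigma> (k + j)))"
    by (auto intro!: eq_matI)
  moreover have "det ?R = det (mat k k (\<lambda>(i, j). ?R $$ (i, j)))"
    by (rule det_unit_columns_right) auto
  moreover have "mat k k (\<lambda>(i, j). ?R $$ (i, j)) = mat k k (\<lambda>(r, c). M (\<sigma> r) c)"
    by (auto intro!: eq_matI)
  ultimately show ?thesis by simp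
qed

lemma det_shuffle_rows:
  fixes M :: "nat \<Rightarrow> nat \<Rightarrow> 'a :: comm_ring_1"
  assumes "box_conjugate k l a b"
  shows "det (mat (k + l) (k + l) (\<lambda>(r, c). M (shuffle_perm k a b r) c)) =
    (\<Prod>i<k. (-1) ^ (a i + (k - 1 - i))) * det (mat (k + l) (k + l) (\<lambda>(r, c). M r c))"
proof -
  let ?N = "k + l"
  let ?P = "mat ?N ?N (\<lambda>(r, c). if shuffle_perm k a b r = c then 1 else 0 :: 'a)"
  let ?M = "mat ?N ?N (\<lambda>(r, c). M r c)"
  have "mat ?N ?N (\<lambda>(r, c). M (shuffle_perm k a b r) c) = ?P * ?M"
  proof (rule eq_matI)
    fix r c assume "r < dim_row (?P * ?M)" "c < dim_col (?P * ?M)"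
    then have rc: "r < ?N" "c < ?N" by auto
    have "(\<Sum>p<?N. (if shuffle_perm k a b r = p then 1 else 0) * M p c) =
        (\<Sum>p<?N. if shuffle_perm k a b r = p then M p c else 0)"
      by (intro sum.cong) auto
    then show "mat ?N ?N (\<lambda>(r, c). M (shuffle_perm k a b r) c) $$ (r, c) = (?P * ?M) $$ (r, c)"
      using rc shuffle_perm_less[OF assms] by (simp add: scalar_prod_def atLeast0LessThan)
  qed auto
  then show ?thesis
    by (simp add: det_mult[of _ ?N] det_shuffle_perm[OF assms])
qed

section \<open>Auxiliary facts on determinants and sums\<close>

lemma det_unit_upper_triangular:
  fixes A :: "'a :: comm_ring_1 mat"
  assumes "A \<in> carrier_mat n n" "\<And>i j. j < i \<Longrightarrow> i < n \<Longrightarrow> A $$ (i, j) = 0"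
    and "\<And>i. i < n \<Longrightarrow> A $$ (i, i) = 1"
  shows "det A = 1"
proof -
  have "det A = prod_list (diag_mat A)"
    using assms by (intro det_upper_triangular) auto
  then show ?thesis
    using assms(1,3) by (simp add: prod_list_diag_prod)
qed

text \<open>Every term of the Leibniz expansion contains each \<open>u i\<close> and each
  \<open>v j\<close> exactly once.\<close>

lemma det_scale_rows_cols:
  fixes z :: "nat \<Rightarrow> nat \<Rightarrow> 'a :: comm_ring_1"
  shows "det (mat n n (\<lambda>(i, j). u i * v j * z i j)) =
    (\<Prod>i<n. u i) * (\<Prod>j<n. v j) * det (mat n n (\<lambda>(i, j). z i j))"
proof -
  have "(\<Prod>i<n. u i * v (p i) * z i (p i)) =
      (\<Prod>i<n. u i) * (\<Prod>j<n. v j) * (\<Prod>i<n. z i (p i))" if "p permutes {..<n}" for p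
    using prod.permute[OF that, of v] by (simp add: prod.distrib)
  moreover have "p i < n" if "p permutes {..<n}" "i < n" for p i
    using that permutes_in_image[of p "{..<n}" i] by simp
  ultimately show ?thesis
    by (simp add: det_def' [of _ n] atLeast0LessThan sum_distrib_left algebra_simps cong: prod.cong_simp)
qed

lemma sum_lessThan_add_nat:
  fixes f :: "nat \<Rightarrow> 'a :: comm_monoid_add"
  shows "(\<Sum>c<k + l. f c) = (\<Sum>c<k. f c) + (\<Sum>j<l. f (k + j))"
  by (induction l) (simp_all add: add.assoc)

section \<open>Dual sequences\<close>

definition alt :: "(int \<Rightarrow> 'a) \<Rightarrow> int \<Rightarrow> 'a :: comm_ring_1" where
  "alt y n = (if even n then y n else - y n)"

text \<open>The generating functions of \<open>x n\<close> and of \<open>(-1) ^ n * y n\<close> are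
  mutually inverse. Abstracting from \<open>h\<close> and \<open>e\<close> allows using each result
  with the two exchanged.\<close>

locale dual_sequences =
  fixes x y :: "int \<Rightarrow> 'a :: comm_ring_1"
  assumes x_neg: "\<And>n. n < 0 \<Longrightarrow> x n = 0" and y_neg: "\<And>n. n < 0 \<Longrightarrow> y n = 0"
    and x_0: "x 0 = 1" and y_0: "y 0 = 1"
    and dual: "\<And>n. 0 < n \<Longrightarrow> (\<Sum>i\<le>n. (-1) ^ i * y (int i) * x (int n - int i)) = 0"
begin

lemma alt_neg: "n < 0 \<Longrightarrow> alt y n = 0"
  by (simp add: alt_def y_neg)

text \<open>Only \<open>t\<close> between \<open>q\<close> and \<open>p\<close> contributes; with
  \<open>t = q + i\<close> the sum becomes the duality relation of degree
  \<open>p - q\<close>.\<close>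

lemma toeplitz_inverse:
  assumes "p < N" "q < N"
  shows "(\<Sum>t<N. x (int p - int t) * alt y (int t - int q)) = (if p = q then 1 else 0)"
proof -
  have "(\<Sum>t<N. x (int p - int t) * alt y (int t - int q)) =
      (\<Sum>t\<in>{q..p}. x (int p - int t) * alt y (int t - int q))"
    using assms by (intro sum.mono_neutral_right) (auto simp: x_neg alt_neg not_le)
  also have "\<dots> = (if p = q then 1 else 0)"
  proof (cases "p < q")
    case False
    then have "(\<Sum>t\<in>{q..p}. x (int p - int t) * alt y (int t - int q)) =
        (\<Sum>i\<le>p - q. (-1) ^ i * y (int i) * x (int (p - q) - int i))"
      by (intro sum.reindex_bij_witness[of _ "\<lambda>i. q + i" "\<lambda>t. t - q"])
        (auto simp: alt_def algebra_simps of_nat_diff minus_one_power_iff)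
    also have "\<dots> = (if p = q then 1 else 0)"
      using dual[of "p - q"] False by (auto simp: x_0 y_0)
    finally show ?thesis .
  qed simp
  finally show ?thesis .
qed

section \<open>The folded Toeplitz matrix and its inverse\<close>

text \<open>
  Columns \<open>c < k\<close> are numbered from right to left, so that \<open>c = j - 1\<close> is the \<open>j\<close>-th column of the
  determinant \<open>det (x (\<lambda>\<^sub>i - i + j) - x (\<lambda>\<^sub>i - i - j))\<close>.
\<close>

definition folded :: "nat \<Rightarrow> nat \<Rightarrow> nat \<Rightarrow> 'a" where
  "folded k p c = (if c < k then x (int p - (int k - 1 - int c)) - x (int p - int k - 1 - int c)
     else x (int p - int c))"

text \<open>Row \<open>k + j\<close> receives row \<open>k - j\<close>, the operation inverse to the
  folding of columns. Row \<open>k\<close> is the axis of the reflection and stays as it is; when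
  \<open>2 * k - c\<close> is negative the added term vanishes.\<close>

definition unfolded :: "nat \<Rightarrow> nat \<Rightarrow> nat \<Rightarrow> 'a" where
  "unfolded k c q = (if c < k then alt y (int k - 1 - int c - int q)
     else alt y (int c - int q) + (if c = k then 0 else alt y (2 * int k - int c - int q)))"

lemma folded_inverse:
  assumes "p < k + l" "q < k + l"
  shows "(\<Sum>c<k + l. folded k p c * unfolded k c q) = (if p = q then 1 else 0)"
proof -
  define g where "g j = x (int p - int k - 1 - int j) * alt y (int k - 1 - int j - int q)" for j
  define f where "f t = x (int p - int t) * alt y (int t - int q)" for t
  define F where "F j = (if j = 0 then 0 else x (int p - int k - int j) * alt y (int k - int j - int q))" for j
  have "(\<Sum>c<k. folded k p c * unfolded k c q) = (\<Sum>c<k. f (k - Suc c)) - (\<Sum>c<k. g c)"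
    by (simp add: folded_def unfolded_def f_def g_def algebra_simps of_nat_diff flip: sum_subtractf)
  moreover have "(\<Sum>c<k. f (k - Suc c)) = (\<Sum>t<k. f t)"
    by (rule sum.nat_diff_reindex)
  moreover have "(\<Sum>j<l. folded k p (k + j) * unfolded k (k + j) q) = (\<Sum>j<l. f (k + j)) + (\<Sum>j<l. F j)"
    unfolding sum.distrib[symmetric]
    by (rule sum.cong) (simp_all add: folded_def unfolded_def f_def F_def algebra_simps)
  \<comment> \<open>The cross terms of the column and row operations must cancel although one sum
    runs to \<open>k\<close> and the other to \<open>l\<close>. Both extend to a common range:
    \<open>F j\<close> vanishes for \<open>j \<ge> l\<close> because \<open>p < k + l\<close>, and
    \<open>g j\<close> vanishes for \<open>j \<ge> k\<close> because the argument of
    \<open>alt y\<close> is negative. The term \<open>F 0 = 0\<close> absorbs the index shift by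
    one.\<close>
  moreover have "(\<Sum>j<l. F j) = (\<Sum>j<k. g j)"
  proof -
    have "(\<Sum>j<l. F j) = (\<Sum>j<Suc (k + l). F j)"
      using assms(1) by (intro sum.mono_neutral_left) (auto simp: F_def x_neg)
    also have "\<dots> = (\<Sum>j<k + l. g j)"
      by (subst sum.lessThan_Suc_shift) (simp add: F_def g_def algebra_simps)
    also have "\<dots> = (\<Sum>j<k. g j)"
      by (intro sum.mono_neutral_right) (auto simp: g_def alt_neg)
    finally show ?thesis .
  qed
  ultimately have "(\<Sum>c<k + l. folded k p c * unfolded k c q) = (\<Sum>t<k + l. f t)"
    by (simp add: sum_lessThan_add_nat)
  then show ?thesis
    using toeplitz_inverse[OF assms] by (simp add: f_def)
qed

text \<open>The full determinant is found by taking the complementary minors of the empty partition: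
  there both minors are unitriangular, and only the sign of the row reversal remains.\<close>

lemma det_folded:
  "(\<Prod>i<k. (-1) ^ (k - 1 - i)) * det (mat (k + l) (k + l) (\<lambda>(r, c). folded k r c)) = 1"
proof -
  let ?\<sigma> = "shuffle_perm k (\<lambda>_. 0) (\<lambda>_. 0)"
  have bc: "box_conjugate k l (\<lambda>_. 0) (\<lambda>_. 0)" by (simp add: box_conjugate_def)
  have "det (mat k k (\<lambda>(r, c). folded k (?\<sigma> r) c)) =
      det (mat (k + l) (k + l) (\<lambda>(r, c). folded k (?\<sigma> r) c)) *
      det (mat l l (\<lambda>(i, j). unfolded k (k + i) (?\<sigma> (k + j))))"
    by (rule complementary_minor)
      (use folded_inverse shuffle_perm_less[OF bc] shuffle_perm_inj_on[OF bc] in auto)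
  moreover have "det (mat k k (\<lambda>(r, c). folded k (?\<sigma> r) c)) = 1"
    by (rule det_unit_upper_triangular[of _ k])
      (auto simp: folded_def shuffle_perm_def of_nat_diff x_neg x_0)
  moreover have "det (transpose_mat (mat l l (\<lambda>(i, j). unfolded k (k + i) (?\<sigma> (k + j))))) = 1"
    by (rule det_unit_upper_triangular[of _ l])
      (auto simp: unfolded_def shuffle_perm_def alt_neg alt_def y_0 y_neg)
  ultimately show ?thesis
    by (simp add: det_transpose[of _ l] det_shuffle_rows[OF bc])
qed

text \<open>With indices from 0, the argument \<open>-i-j+2\<close> of the plus form becomes
  \<open>-i-j\<close>. The case \<open>j = 0\<close> keeps one of two equal summands, so the doubled
  first column, and with it the factor one half, is avoided.\<close>

theorem det_conjugate:
  assumes bc: "box_conjugate k l a b"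
  shows "det (mat k k (\<lambda>(r, c). x (int (a r) - int r + int c) - x (int (a r) - int r - int c - 2))) =
    det (mat l l (\<lambda>(i, j). y (int (b i) - int i + int j) +
      (if j = 0 then 0 else y (int (b i) - int i - int j))))"
proof -
  let ?\<sigma> = "shuffle_perm k a b"
  let ?E = "\<lambda>i j. y (int (b i) - int i + int j) + (if j = 0 then 0 else y (int (b i) - int i - int j))"
  let ?D = "det (mat l l (\<lambda>(i, j). ?E i j))"
  have "mat k k (\<lambda>(r, c). x (int (a r) - int r + int c) - x (int (a r) - int r - int c - 2)) =
      mat k k (\<lambda>(r, c). folded k (?\<sigma> r) c)"
    by (rule eq_matI) (auto simp: folded_def shuffle_perm_def of_nat_diff algebra_simps)
  moreover have "det (mat k k (\<lambda>(r, c). folded k (?\<sigma> r) c)) =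
      det (mat (k + l) (k + l) (\<lambda>(r, c). folded k (?\<sigma> r) c)) *
      det (mat l l (\<lambda>(i, j). unfolded k (k + i) (?\<sigma> (k + j))))"
    by (rule complementary_minor)
      (use folded_inverse shuffle_perm_less[OF bc] shuffle_perm_inj_on[OF bc] in auto)
  \<comment> \<open>The staircase part of the permutation sign cancels against
    \<open>det_folded\<close>, leaving the parity of the number of cells, counted by
    columns.\<close>
  moreover have "det (mat (k + l) (k + l) (\<lambda>(r, c). folded k (?\<sigma> r) c)) = (\<Prod>j<l. (-1) ^ b j)"
  proof -
    have "det (mat (k + l) (k + l) (\<lambda>(r, c). folded k (?\<sigma> r) c)) = (\<Prod>i<k. (-1) ^ a i)"
      unfolding det_shuffle_rows[OF bc] power_add prod.distrib mult.assoc det_folded by simp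
    then show ?thesis
      by (simp add: box_conjugate_sum[OF bc] flip: power_sum)
  qed
  moreover have "det (mat l l (\<lambda>(i, j). unfolded k (k + i) (?\<sigma> (k + j)))) = (\<Prod>j<l. (-1) ^ b j) * ?D"
  proof -
    \<comment> \<open>Both summands have arguments of the parity of \<open>i + j + b j\<close>, so
      they share one sign, which splits into a row factor and a column factor. Transposition then
      puts the entries into the order of \<open>?E\<close>.\<close>
    have "unfolded k (k + i) (?\<sigma> (k + j)) = (-1) ^ i * (-1) ^ (j + b j) * ?E j i"
      if ij: "i < l" "j < l" for i j
    proof -
      have "b j \<le> k" using bc ij by (auto simp: box_conjugate_def)
      then have "unfolded k (k + i) (?\<sigma> (k + j)) = alt y (int (b j) - int j + int i) +
          (if i = 0 then 0 else alt y (int (b j) - int j - int i))"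
        by (auto simp: unfolded_def shuffle_perm_def of_nat_diff algebra_simps)
      also have "\<dots> = (-1) ^ i * (-1) ^ (j + b j) * ?E j i"
        by (auto simp: alt_def minus_one_power_iff)
      finally show ?thesis .
    qed
    then have "mat l l (\<lambda>(i, j). unfolded k (k + i) (?\<sigma> (k + j))) =
        mat l l (\<lambda>(i, j). (-1) ^ i * (-1) ^ (j + b j) * ?E j i)"
      by (intro eq_matI) simp_all
    moreover have "det (mat l l (\<lambda>(i, j). (-1) ^ i * (-1) ^ (j + b j) * ?E j i)) =
        (\<Prod>i<l. (-1) ^ i) * (\<Prod>j<l. (-1) ^ (j + b j)) * det (mat l l (\<lambda>(i, j). ?E j i))"
      by (rule det_scale_rows_cols)
    moreover have "(\<Prod>i<l. (-1) ^ i) * (\<Prod>j<l. (-1) ^ (j + b j)) = (\<Prod>j<l. (-1 :: 'a) ^ b j)"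
      unfolding prod.distrib[symmetric]
      by (intro prod.cong) (auto simp: minus_one_power_iff)
    moreover have "mat l l (\<lambda>(i, j). ?E j i) = transpose_mat (mat l l (\<lambda>(i, j). ?E i j))"
      by (rule eq_matI) auto
    moreover have "det (transpose_mat (mat l l (\<lambda>(i, j). ?E i j))) = ?D"
      by (rule det_transpose[of _ l]) simp
    ultimately show ?thesis by (simp only:)
  qed
  moreover have "(\<Prod>j<l. (-1) ^ b j) * ((\<Prod>j<l. (-1) ^ b j) * ?D) = ?D"
    unfolding mult.assoc[symmetric] prod.distrib[symmetric] power_add[symmetric]
    by (simp flip: mult_2 power_mult)
  ultimately show ?thesis by (simp only:)
qed

end

section \<open>The relation between the functions h and e\<close>

lemma coefficient_sum: "coefficient (\<Sum>i\<in>A. f i) m = (\<Sum>i\<in>A. coefficient (f i) m)"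
  by (induction A rule: infinite_finite_induct)
    (simp_all add: zero_symfun.rep_eq plus_symfun.rep_eq)

lemma coefficient_minus_one_power: "coefficient ((-1) ^ i * f) m = (-1) ^ i * coefficient f m"
  by (induction i) (simp_all add: uminus_symfun.rep_eq)

lemma sum_minus_one_power_card_Pow:
  assumes "finite A" "A \<noteq> {}"
  shows "(\<Sum>S\<in>Pow A. (-1) ^ card S) = (0 :: rat)"
  by (rule sum_alternating_cancels) (use assms card_subsupersets_even_odd[of A "{}"] in auto)

definition indicator_monomial :: "nat set \<Rightarrow> monomial" where
  "indicator_monomial S = (\<Sum>i\<in>S. Poly_Mapping.single i 1)"

lemma lookup_indicator_monomial:
  "finite S \<Longrightarrow> Poly_Mapping.lookup (indicator_monomial S) i = (if i \<in> S then 1 else 0)"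
  by (simp add: indicator_monomial_def lookup_sum lookup_single when_def)

lemma mdeg_squarefree:
  "\<forall>i. Poly_Mapping.lookup m i \<le> 1 \<Longrightarrow> mdeg m = card (Poly_Mapping.keys m)"
proof -
  assume *: "\<forall>i. Poly_Mapping.lookup m i \<le> 1"
  have "Poly_Mapping.lookup m i = 1" if "i \<in> Poly_Mapping.keys m" for i
    using * that by (metis in_keys_iff le_neq_implies_less less_one)
  then show ?thesis by (simp add: mdeg_def)
qed

text \<open>Squarefree divisors of \<open>m\<close> correspond to subsets of its support, which is
  nonempty, so the alternating sum cancels.\<close>

lemma sum_squarefree_divisors:
  assumes "m \<noteq> (0 :: monomial)"
  shows "(\<Sum>p | fst p + snd p = m \<and> (\<forall>i. Poly_Mapping.lookup (fst p) i \<le> 1).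
    (-1) ^ mdeg (fst p)) = (0 :: rat)"
proof -
  have "(\<Sum>p | fst p + snd p = m \<and> (\<forall>i. Poly_Mapping.lookup (fst p) i \<le> 1).
      (-1) ^ mdeg (fst p)) = (\<Sum>S\<in>Pow (Poly_Mapping.keys m). (-1 :: rat) ^ card S)"
  proof (rule sum.reindex_bij_witness[of _
        "\<lambda>S. (indicator_monomial S, m - indicator_monomial S)" "\<lambda>p. Poly_Mapping.keys (fst p)"])
    fix p :: "monomial \<times> monomial"
    assume p: "p \<in> {p. fst p + snd p = m \<and> (\<forall>i. Poly_Mapping.lookup (fst p) i \<le> 1)}"
    have ind: "indicator_monomial (Poly_Mapping.keys (fst p)) = fst p"
    proof (rule poly_mapping_eqI)
      fix i
      have "Poly_Mapping.lookup (fst p) i \<le> 1" using p by simp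
      then show "Poly_Mapping.lookup (indicator_monomial (Poly_Mapping.keys (fst p))) i =
          Poly_Mapping.lookup (fst p) i"
        by (auto simp: lookup_indicator_monomial in_keys_iff)
    qed
    show "(indicator_monomial (Poly_Mapping.keys (fst p)),
        m - indicator_monomial (Poly_Mapping.keys (fst p))) = p"
      unfolding ind using p by (auto simp: prod_eq_iff)
    show "Poly_Mapping.keys (fst p) \<in> Pow (Poly_Mapping.keys m)"
      using p by (auto simp: in_keys_iff lookup_add)
    show "(-1 :: rat) ^ card (Poly_Mapping.keys (fst p)) = (-1) ^ mdeg (fst p)"
      using p by (simp add: mdeg_squarefree)
  next
    fix S assume "S \<in> Pow (Poly_Mapping.keys m)"
    then have S: "S \<subseteq> Poly_Mapping.keys m" "finite S"
      by (auto intro: finite_subset)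
    show "Poly_Mapping.keys (fst (indicator_monomial S, m - indicator_monomial S)) = S"
      using S(2) by (auto simp: in_keys_iff lookup_indicator_monomial split: if_splits)
    have "indicator_monomial S + (m - indicator_monomial S) = m"
      using S by (auto intro!: poly_mapping_eqI simp: lookup_add lookup_minus
          lookup_indicator_monomial in_keys_iff)
    then show "(indicator_monomial S, m - indicator_monomial S) \<in>
        {p. fst p + snd p = m \<and> (\<forall>i. Poly_Mapping.lookup (fst p) i \<le> 1)}"
      using S(2) by (simp add: lookup_indicator_monomial)
  qed
  also have "\<dots> = 0"
    using assms by (intro sum_minus_one_power_card_Pow) auto
  finally show ?thesis .
qed

lemma sum_e_h:
  assumes "0 < n"
  shows "(\<Sum>i\<le>n. (-1) ^ i * e (int i) * h (int n - int i)) = 0"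
proof (rule coefficient_inject[THEN iffD1], rule ext)
  fix m
  let ?sf = "\<lambda>p :: monomial \<times> monomial. \<forall>i. Poly_Mapping.lookup (fst p) i \<le> 1"
  have "coefficient (\<Sum>i\<le>n. (-1) ^ i * e (int i) * h (int n - int i)) m =
      (\<Sum>i\<le>n. (-1) ^ i * (\<Sum>p | fst p + snd p = m.
        coefficient (e (int i)) (fst p) * coefficient (h (int n - int i)) (snd p)))"
    by (simp only: coefficient_sum mult.assoc coefficient_minus_one_power)
      (simp add: times_symfun.rep_eq conv_alt)
  \<comment> \<open>For a fixed splitting of \<open>m\<close>, only the index \<open>i\<close> equal
    to the degree of its first factor contributes; the second factor then forces \<open>m\<close> to
    have degree \<open>n\<close>.\<close>
  also have "\<dots> = (\<Sum>p | fst p + snd p = m. \<Sum>i\<le>n.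
      if i = mdeg (fst p) then if mdeg m = n \<and> ?sf p then (-1) ^ i else 0 else 0)"
    unfolding sum_distrib_left
    by (subst sum.swap, intro sum.cong) (auto simp: e.rep_eq h.rep_eq mdeg_add)
  also have "\<dots> = (\<Sum>p | fst p + snd p = m. if mdeg m = n \<and> ?sf p then (-1) ^ mdeg (fst p) else 0)"
    by (intro sum.cong) (auto simp: mdeg_add)
  also have "\<dots> = (if mdeg m = n then \<Sum>p | fst p + snd p = m \<and> ?sf p. (-1) ^ mdeg (fst p) else 0)"
    using sum.inter_filter[OF finite_splits'[of m], of "\<lambda>p. (-1 :: rat) ^ mdeg (fst p)" ?sf] by simp
  also have "\<dots> = 0"
    using sum_squarefree_divisors[of m] mdeg_eq_0_iff[of m] assms by (cases "m = 0") auto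
  finally show "coefficient (\<Sum>i\<le>n. (-1) ^ i * e (int i) * h (int n - int i)) m = coefficient 0 m"
    by (simp add: zero_symfun.rep_eq)
qed

text \<open>Reversing the order of summation gives the previous identity up to the factor
  \<open>(-1) ^ n\<close>.\<close>

lemma sum_h_e:
  assumes "0 < n"
  shows "(\<Sum>i\<le>n. (-1) ^ i * h (int i) * e (int n - int i)) = 0"
proof -
  have "(\<Sum>i\<le>n. (-1) ^ i * h (int i) * e (int n - int i)) =
      (\<Sum>i\<le>n. (-1) ^ n * ((-1) ^ i * e (int i) * h (int n - int i)))"
    by (rule sum.reindex_bij_witness[of _ "\<lambda>i. n - i" "\<lambda>i. n - i"])
      (auto simp: of_nat_diff minus_one_power_iff)
  then show ?thesis
    using sum_e_h[OF assms] by (simp flip: sum_distrib_left)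
qed

section \<open>Determinants of partitions\<close>

lemma check_recurrence:
  fixes f :: "int \<Rightarrow> 'a :: comm_ring_1"
  assumes neg: "\<And>n. n < 0 \<Longrightarrow> f n = 0"
  shows "(\<Sum>r\<le>nat n. f (n - 2 * int r)) - (\<Sum>r\<le>nat (n - 2). f (n - 2 - 2 * int r)) = f n"
proof -
  \<comment> \<open>Beyond \<open>nat n\<close> all indices are negative, so the two truncations can
    be brought to lengths at which the sums telescope.\<close>
  have extend: "(\<Sum>r\<le>nat n. f (n - 2 * int r)) = (\<Sum>r\<le>K. f (n - 2 * int r))" if "nat n \<le> K" for n K
    using that by (intro sum.mono_neutral_left) (auto intro!: neg)
  have "(\<Sum>r\<le>nat n. f (n - 2 * int r)) = (\<Sum>r\<le>Suc (nat n). f (n - 2 * int r))"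
    by (rule extend) simp
  also have "\<dots> = f n + (\<Sum>r\<le>nat n. f (n - 2 - 2 * int r))"
    by (subst sum.atMost_Suc_shift) (simp add: algebra_simps)
  also have "(\<Sum>r\<le>nat n. f (n - 2 - 2 * int r)) = (\<Sum>r\<le>nat (n - 2). f (n - 2 - 2 * int r))"
    by (rule extend[symmetric]) simp
  finally show ?thesis by simp
qed

text \<open>The column operation is right multiplication by the triangular matrix \<open>U\<close>,
  whose determinant is its corner entry \<open>d\<close>. The value \<open>d = 2\<close> gives the
  plain plus form, and \<open>d = 1\<close> the form produced by
  \<open>det_conjugate\<close>.\<close>

lemma det_plus_eq_det_minus:
  fixes f g :: "int \<Rightarrow> 'a :: comm_ring_1"
  assumes fg: "\<And>n. f n = g n - g (n - 2)" and "0 < k"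
  shows "detij k (\<lambda>i j. if j = 1 then d * f (\<alpha> i + 1) else f (\<alpha> i + j) + f (\<alpha> i - j + 2)) =
    d * detij k (\<lambda>i j. g (\<alpha> i + j) - g (\<alpha> i - j))"
proof -
  define U where "U = mat k k (\<lambda>(r, c).
    (if r = c then if c = 0 then d else 1 else 0) - (if r + 2 = c then 1 else 0))"
  define G where "G i c = g (\<alpha> (int i + 1) + (int c + 1)) - g (\<alpha> (int i + 1) - (int c + 1))" for i c
  have "mat k k (\<lambda>(r, c). if int c + 1 = 1 then d * f (\<alpha> (int r + 1) + 1)
      else f (\<alpha> (int r + 1) + (int c + 1)) + f (\<alpha> (int r + 1) - (int c + 1) + 2)) =
    mat k k (\<lambda>(r, c). G r c) * U" (is "?F = ?G * U")
  proof (rule eq_matI)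
    fix r c assume "r < dim_row (?G * U)" "c < dim_col (?G * U)"
    then have rc: "r < k" "c < k" by (auto simp: U_def)
    have "(?G * U) $$ (r, c) = (\<Sum>s<k. G r s *
        ((if s = c then if c = 0 then d else 1 else 0) - (if s + 2 = c then 1 else 0)))"
      using rc by (simp add: U_def scalar_prod_def atLeast0LessThan)
    also have "\<dots> = (\<Sum>s<k. if s = c then G r s * (if c = 0 then d else 1) else 0) -
        (\<Sum>s<k. if s + 2 = c then G r s else 0)"
      unfolding sum_subtractf[symmetric] by (intro sum.cong) auto
    also have "(\<Sum>s<k. if s + 2 = c then G r s else 0) =
        (\<Sum>s<k. if s = c - 2 then if 2 \<le> c then G r s else 0 else 0)"
      by (intro sum.cong) auto
    also have "(\<Sum>s<k. if s = c then G r s * (if c = 0 then d else 1) else 0) - \<dots> =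
        G r c * (if c = 0 then d else 1) - (if 2 \<le> c then G r (c - 2) else 0)"
      using rc by auto
    also have "\<dots> = ?F $$ (r, c)"
    proof -
      \<comment> \<open>For \<open>c = 1\<close> nothing is subtracted: the column of index
        \<open>j = 0\<close> in the minus form would be zero.\<close>
      consider "c = 0" | "c = 1" | "2 \<le> c" by linarith
      then show ?thesis
        using rc by cases (auto simp: G_def fg algebra_simps of_nat_diff)
    qed
    finally show "?F $$ (r, c) = (?G * U) $$ (r, c)" by simp
  qed (auto simp: U_def)
  moreover have "det U = d"
  proof -
    have "det U = prod_list (diag_mat U)"
      by (rule det_upper_triangular[of _ k]) (auto simp: U_def)
    also have "\<dots> = (\<Prod>i<k. if i = 0 then d else 1)"
      by (simp add: prod_list_diag_prod U_def atLeast0LessThan)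
    also have "\<dots> = d" using \<open>0 < k\<close> by simp
    finally show ?thesis .
  qed
  moreover have "det (?G * U) = det ?G * det U"
    by (rule det_mult[of _ k]) (auto simp: U_def)
  ultimately show ?thesis
    by (simp add: detij_def G_def mult.commute)
qed

lemma part_Suc: "i < length lam \<Longrightarrow> part lam (int i + 1) = int (lam ! i)"
  by (simp add: part_def)

text \<open>The rows longer than \<open>j\<close> form an initial segment because the parts decrease
  weakly, so \<open>i\<close> belongs to it exactly when \<open>i\<close> is below its cardinality,
  the conjugate part.\<close>

lemma box_conjugate_partition:
  assumes "is_partition lam" "is_conjugate lam mu"
  shows "box_conjugate (length lam) (length mu) ((!) lam) ((!) mu)"
proof -
  define A where "A j = {i. i < length lam \<and> j < lam ! i}" for j
  have mu: "part mu (int j + 1) = int (card (A j))" for j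
  proof -
    have "{i. 1 \<le> i \<and> i \<le> int (length lam) \<and> part lam i \<ge> int j + 1} = (\<lambda>i. int i + 1) ` A j"
    proof (intro equalityI subsetI)
      fix i assume "i \<in> {i. 1 \<le> i \<and> i \<le> int (length lam) \<and> part lam i \<ge> int j + 1}"
      then have "nat (i - 1) \<in> A j" "i = int (nat (i - 1)) + 1"
        by (auto simp: A_def part_def)
      then show "i \<in> (\<lambda>i. int i + 1) ` A j" by blast
    qed (auto simp: A_def part_def)
    moreover have "inj_on (\<lambda>i. int i + 1) (A j)" by (auto simp: inj_on_def)
    ultimately show ?thesis
      using assms(2) by (simp add: is_conjugate_def card_image)
  qed
  have antimono: "lam ! j \<le> lam ! i" if "i \<le> j" "j < length lam" for i j
  proof (cases "i = j")
    case False
    then have "i < j" using that(1) by simp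
    then show ?thesis
      using assms(1) that(2) sorted_wrt_nth_less[of "(\<ge>)" lam i j] by (simp add: is_partition_def)
  qed simp
  have fin: "finite (A j)" for j by (simp add: A_def)
  have cardA: "i < card (A j) \<longleftrightarrow> j < lam ! i" if i: "i < length lam" for i j
  proof
    assume "j < lam ! i"
    then have "i' \<in> A j" if "i' \<le> i" for i'
      using antimono[OF that i] that i by (simp add: A_def)
    then have "card {..i} \<le> card (A j)"
      by (intro card_mono fin) auto
    then show "i < card (A j)" by simp
  next
    assume *: "i < card (A j)"
    show "j < lam ! i"
    proof (rule ccontr)
      assume nj: "\<not> j < lam ! i"
      have "i' < i" if "i' \<in> A j" for i'
      proof (rule ccontr)
        assume "\<not> i' < i"
        then have "lam ! i' \<le> lam ! i"
          using that by (intro antimono) (simp_all add: A_def)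
        then show False using nj that by (auto simp: A_def)
      qed
      then have "card (A j) \<le> card {..<i}" by (intro card_mono) auto
      then show False using * by simp
    qed
  qed
  have mu': "mu ! j = card (A j)" if "j < length mu" for j
    using mu[of j] that by (simp add: part_Suc)
  \<comment> \<open>\<open>part mu\<close> is zero past the end of the list, so by conjugacy no row
    can be longer than \<open>length mu\<close>.\<close>
  have "lam ! i \<le> length mu" if "i < length lam" for i
  proof (rule ccontr)
    assume "\<not> lam ! i \<le> length mu"
    then have "0 < card (A (length mu))" using cardA[OF that, of "length mu"] by simp
    then show False using mu[of "length mu"] by (simp add: part_def)
  qed
  moreover have "card (A j) \<le> length lam" for j
    using card_mono[of "{..<length lam}" "A j"] by (auto simp: A_def)
  ultimately show ?thesis
    by (simp add: box_conjugate_def mu' cardA)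
qed

text \<open>\<open>det_conjugate\<close> followed by the column operation with \<open>d = 1\<close>.
  When \<open>g\<close> is the check sequence of \<open>y\<close>, both sides are minus
  forms.\<close>

lemma (in dual_sequences) detij_conjugate:
  assumes bc: "box_conjugate (length lam) (length mu) ((!) lam) ((!) mu)"
    and yg: "\<And>n. y n = g n - g (n - 2)" and "0 < length mu"
  shows "detij (length lam) (\<lambda>i j. x (part lam i - i + j) - x (part lam i - i - j)) =
    detij (length mu) (\<lambda>i j. g (part mu i - i + j) - g (part mu i - i - j))"
proof -
  have "detij (length lam) (\<lambda>i j. x (part lam i - i + j) - x (part lam i - i - j)) =
      det (mat (length lam) (length lam) (\<lambda>(r, c). x (int (lam ! r) - int r + int c) -
        x (int (lam ! r) - int r - int c - 2)))"
    unfolding detij_def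
    by (intro arg_cong[where f = det] eq_matI) (simp_all add: part_Suc, simp_all add: algebra_simps)
  also note det_conjugate[OF bc]
  also have "det (mat (length mu) (length mu) (\<lambda>(i, j). y (int (mu ! i) - int i + int j) +
        (if j = 0 then 0 else y (int (mu ! i) - int i - int j)))) =
      detij (length mu) (\<lambda>i j. if j = 1 then 1 * y (part mu i - i + 1)
        else y (part mu i - i + j) + y (part mu i - i - j + 2))"
    unfolding detij_def
    by (intro arg_cong[where f = det] eq_matI) (simp_all add: part_Suc, simp_all add: algebra_simps)
  also have "\<dots> = 1 * detij (length mu) (\<lambda>i j. g (part mu i - i + j) - g (part mu i - i - j))"
    using yg assms(3) by (rule det_plus_eq_det_minus)
  finally show ?thesis by simp
qed

section \<open>The factor one half and the assembly of all formulas\<close>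

lemma qscale_half_double: "(1/2) *\<^sub>Q (2 * z) = z"
  unfolding mult_2 by transfer (simp add: fun_eq_iff)

text \<open>For \<open>j = 1\<close> the two summands coincide, so the first column is doubled and
  the case \<open>d = 2\<close> applies.\<close>

lemma half_detij:
  assumes "\<And>n. f n = g n - g (n - 2)" "0 < k"
  shows "(1/2) *\<^sub>Q detij k (\<lambda>i j. f (\<alpha> i + j) + f (\<alpha> i - j + 2)) =
    detij k (\<lambda>i j. g (\<alpha> i + j) - g (\<alpha> i - j))"
proof -
  have "(\<lambda>i j. f (\<alpha> i + j) + f (\<alpha> i - j + 2)) =
      (\<lambda>i j. if j = 1 then 2 * f (\<alpha> i + 1) else f (\<alpha> i + j) + f (\<alpha> i - j + 2))"
    by (intro ext) (simp add: add.commute)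
  then show ?thesis
    using det_plus_eq_det_minus[where f = f and g = g and d = 2 and \<alpha> = \<alpha>, OF assms] by (simp add: qscale_half_double)
qed

lemma h_check_recurrence: "h n = h_check n - h_check (n - 2)"
  unfolding h_check_def using check_recurrence[of h n] h_neg by simp

lemma e_check_recurrence: "e n = e_check n - e_check (n - 2)"
  unfolding e_check_def using check_recurrence[of e n] e_neg by simp

interpretation he: dual_sequences h e
  by unfold_locales (simp_all add: h_neg e_neg h_0 e_0 sum_e_h)

interpretation eh: dual_sequences e h
  by unfold_locales (simp_all add: h_neg e_neg h_0 e_0 sum_h_e)

theorem theorem4p6:
  fixes lam lam' :: "nat list" and k l :: nat
  assumes "is_partition lam" and "length lam = k"
    and "is_partition lam'" and "length lam' = l"
    and "is_conjugate lam lam'"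
  shows
    "sp lam = (1/2) *\<^sub>Q detij k (\<lambda>i j. h (part lam i - i + j) + h (part lam i - i - j + 2)) \<and>
     sp lam = detij k (\<lambda>i j. h_check (part lam i - i + j) - h_check (part lam i - i - j)) \<and>
     sp lam = detij l (\<lambda>i j. e (part lam' i - i + j) - e (part lam' i - i - j)) \<and>
     sp lam = (1/2) *\<^sub>Q detij l (\<lambda>i j. e_hat (part lam' i - i + j) + e_hat (part lam' i - i - j + 2)) \<and>
     orth lam = detij k (\<lambda>i j. h (part lam i - i + j) - h (part lam i - i - j)) \<and>
     orth lam = (1/2) *\<^sub>Q detij k (\<lambda>i j. h_hat (part lam i - i + j) + h_hat (part lam i - i - j + 2)) \<and>
     orth lam = (1/2) *\<^sub>Q detij l (\<lambda>i j. e (part lam' i - i + j) + e (part lam' i - i - j + 2)) \<and>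
     orth lam = detij l (\<lambda>i j. e_check (part lam' i - i + j) - e_check (part lam' i - i - j))"
proof -
  have kl: "0 < k" "0 < l"
    using assms by (auto simp: is_partition_def)
  have bc: "box_conjugate (length lam) (length lam') ((!) lam) ((!) lam')"
    using assms(1,5) by (rule box_conjugate_partition)
  \<comment> \<open>These four instances turn every plus form into a minus form, so only two
    identities between minus forms remain.\<close>
  note half = half_detij[where f = h and g = h_check, OF h_check_recurrence kl(1)]
    half_detij[where f = e and g = e_check, OF e_check_recurrence kl(2)]
    half_detij[where f = h_hat and g = h, OF h_hat_def kl(1)]
    half_detij[where f = e_hat and g = e, OF e_hat_def kl(2)]
  \<comment> \<open>The symplectic identity is the orthogonal one with \<open>h\<close> and
    \<open>e\<close> exchanged, applied to the conjugate partition and hence to the transposed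
    box.\<close>
  have "detij l (\<lambda>i j. e (part lam' i - i + j) - e (part lam' i - i - j)) =
      detij k (\<lambda>i j. h_check (part lam i - i + j) - h_check (part lam i - i - j))"
    using eh.detij_conjugate[OF box_conjugate_sym[OF bc] h_check_recurrence] kl assms(2,4) by simp
  moreover have "detij k (\<lambda>i j. h (part lam i - i + j) - h (part lam i - i - j)) =
      detij l (\<lambda>i j. e_check (part lam' i - i + j) - e_check (part lam' i - i - j))"
    using he.detij_conjugate[OF bc e_check_recurrence] kl assms(2,4) by simp
  ultimately show ?thesis
    by (simp add: sp_def orth_def assms(2) half)
qed

end
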